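(* Let $c_0(d,k,\delta,M)>0$ be a function, defined for integers $d\ge 0$, $k\ge 1$ and reals $\delta,M>0$, with the following property: whenever $N$ is prime and $f_{U^\perp}, f_{UAP}:\mathbb{Z}_N\to[0,1]$ satisfy $\|f_{U^\perp}-f_{UAP}\|_{L^2}\le \frac{\delta^2}{1024k}$, $\mathbf{E}(f_{U^\perp}\mid\mathbb{Z}_N)\ge\delta$ and $\|f_{UAP}\|_{UAP^d}<M$, then $\mathbf{E}(\prod_{j=0}^{k-1}T^{\mu jr}f_{U^\perp}(x)\mid x\in\mathbb{Z}_N,\,0\le r\le N_1)\ge c_0(d,k,\delta,M)$ for all $\mu\in\mathbb{Z}_N$ and integers $N_1\ge1$. Let $k \geq 3$ and $\delta > 0$. Then there exists $M_0 = M_0(k,\delta)$ (depending on $k,\delta$ and the function $c_0$, but not on $N$ or $f$) such that: for every prime $N$ and every $f: \mathbb{Z}_N \to [0,1]$ with $\mathbf{E}(f\mid\mathbb{Z}_N) \geq \delta$, there exist a number $0 < M \leq M_0$, a bounded function $f_U: \mathbb{Z}_N \to \mathbb{C}$, and functions $f_{U^\perp}, f_{UAP}: \mathbb{Z}_N \to [0,1]$ such that $f = f_U + f_{U^\perp}$, $$\| f_{U^\perp} - f_{UAP}\|_{L^2} \leq \frac{\delta^2}{1024 k}, \quad \mathbf{E}(f_{U^\perp}\mid\mathbb{Z}_N) \geq \delta, \quad \|f_{UAP}\|_{UAP^{k-2}} < M, \quad \|f_U\|_{U^{k-1}} \leq 2^{-k} c_0(k-2,k,\delta,M).$$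
   Context: $N$ is a prime, $\mathbb{Z}_N=\mathbb{Z}/N\mathbb{Z}$, $\mathbf{E}(F(x)\mid x\in A)$ is the uniform average over a finite set $A$, $T^n f(x):=f(x+n)$, $\|f\|_{L^2}:=\mathbf{E}(|f|^2\mid\mathbb{Z}_N)^{1/2}$, $\|f\|_{L^\infty}:=\sup|f|$; a function is bounded if $\|f\|_{L^\infty}\le1$. Gowers norms: $\|f\|_{U^0} := \mathbf{E}(f\mid\mathbb{Z}_N)$ and for $d \geq 1$, $\|f\|_{U^d} := \mathbf{E}\big(\|\overline{f}\, T^h f\|_{U^{d-1}}^{2^{d-1}} \mid h \in \mathbb{Z}_N\big)^{1/2^d}$ (so $\|f\|_{U^1}=|\mathbf{E}(f\mid\mathbb{Z}_N)|$ and all $U^d$, $d\ge1$, are nonnegative). Banach algebra: a vector space $A$ of functions $\mathbb{Z}_N\to\mathbb{C}$ with a norm invariant under conjugation, closed under pointwise product with $\|fg\|_A\le\|f\|_A\|g\|_A$, and $\|F\|_{L^\infty}\le\|F\|_A$ ($\|f\|_A=\infty$ if $f\notin A$); shift-invariant if $\|T^nf\|_A=\|f\|_A$. For shift-invariant $A$, $UAP[A]$ consists of $F$ with $T^nF=M'\mathbf{E}(c_{n,h}g_h)$ for all $n\in\mathbb{Z}_N$, where $M'\ge0$, $h$ is a random variable in a finite nonempty set $H$, $g_h$ bounded, $c_{n,h}\in A$ with $\|c_{n,h}\|_A\le1$; $\|F\|_{UAP[A]}$ is the infimum of such $M'$. $UAP^0$ = constants with $L^\infty$ norm, $UAP^d:=UAP[UAP^{d-1}]$.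 *)

theory Defs
  imports "HOL-Probability.Probability"
begin

text \<open>
  A function on the cyclic group of order \<open>N\<close> is represented by an \<open>N\<close>-periodic function on the
  integers, and averages over the group are taken over the representatives \<open>{0..<N}\<close>. This keeps
  \<open>N\<close> a term, so that constants can be chosen uniformly in \<open>N\<close>.
\<close>

definition cyc :: "nat \<Rightarrow> int set" where
  "cyc N = {0..<int N}"

definition cyc_fun :: "nat \<Rightarrow> (int \<Rightarrow> 'a) set" where
  "cyc_fun N = {f. \<forall>x. f (x + int N) = f x}"

definition unit_fun :: "nat \<Rightarrow> (int \<Rightarrow> real) set" where
  "unit_fun N = {f \<in> cyc_fun N. \<forall>x. 0 \<le> f x \<and> f x \<le> 1}"

definition avg :: "('i \<Rightarrow> 'a::real_normed_field) \<Rightarrow> 'i set \<Rightarrow> 'a" where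
  "avg F A = (\<Sum>x\<in>A. F x) / of_nat (card A)"

definition shift :: "int \<Rightarrow> (int \<Rightarrow> 'a) \<Rightarrow> int \<Rightarrow> 'a" where
  "shift n f = (\<lambda>x. f (x + n))"

definition L2_norm_cyc :: "nat \<Rightarrow> (int \<Rightarrow> 'a::real_normed_field) \<Rightarrow> real" where
  "L2_norm_cyc N f = sqrt (avg (\<lambda>x. (norm (f x))\<^sup>2) (cyc N))"

definition Linf_norm_cyc :: "nat \<Rightarrow> (int \<Rightarrow> 'a::real_normed_field) \<Rightarrow> real" where
  "Linf_norm_cyc N f = (SUP x\<in>cyc N. norm (f x))"

definition bounded_fun :: "nat \<Rightarrow> (int \<Rightarrow> complex) set" where
  "bounded_fun N = {f \<in> cyc_fun N. Linf_norm_cyc N f \<le> 1}"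

text \<open>
  The value is complex because the order-zero quantity is the mean of \<open>f\<close>. For positive order the
  average under the root is a nonnegative real (at order one it is the squared modulus of the
  mean), so \<open>Re\<close> only changes its type.
\<close>

fun gowers :: "nat \<Rightarrow> nat \<Rightarrow> (int \<Rightarrow> complex) \<Rightarrow> complex" where
  "gowers N 0 f = avg f (cyc N)"
| "gowers N (Suc d) f =
     complex_of_real (root (2 ^ Suc d)
       (Re (avg (\<lambda>h. gowers N d (\<lambda>x. cnj (f x) * shift h f x) ^ (2 ^ d)) (cyc N))))"

definition gowers_norm :: "nat \<Rightarrow> nat \<Rightarrow> (int \<Rightarrow> complex) \<Rightarrow> real" where
  "gowers_norm N d f = Re (gowers N d f)"

text \<open>
  A Banach algebra of functions is represented by its norm, extended by the value \<open>\<infinity>\<close> off the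
  algebra. In \<open>uap_rep N A F M\<close> the law of the random variable \<open>h\<close> is the probability mass
  function \<open>p\<close>; as the set \<open>H\<close> of its values is finite, taking it to be a set of natural numbers is
  no restriction.
\<close>

definition uap_rep ::
    "nat \<Rightarrow> ((int \<Rightarrow> complex) \<Rightarrow> ennreal) \<Rightarrow> (int \<Rightarrow> complex) \<Rightarrow> real \<Rightarrow> bool" where
  "uap_rep N A F M \<longleftrightarrow>
     F \<in> cyc_fun N \<and> 0 \<le> M \<and>
     (\<exists>(H :: nat set) (p :: nat pmf) (g :: nat \<Rightarrow> int \<Rightarrow> complex)
        (c :: int \<Rightarrow> nat \<Rightarrow> int \<Rightarrow> complex).
        finite H \<and> H \<noteq> {} \<and> set_pmf p \<subseteq> H \<and>
        (\<forall>h\<in>H. g h \<in> bounded_fun N) \<and>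
        (\<forall>n\<in>cyc N. \<forall>h\<in>H. c n h \<in> cyc_fun N \<and> A (c n h) \<le> 1) \<and>
        (\<forall>n\<in>cyc N. \<forall>x. shift n F x =
            complex_of_real M * measure_pmf.expectation p (\<lambda>h. c n h x * g h x)))"

text \<open>The infimum of the empty set is \<open>\<infinity>\<close>, which is the value off the algebra.\<close>

definition uap_of ::
    "nat \<Rightarrow> ((int \<Rightarrow> complex) \<Rightarrow> ennreal) \<Rightarrow> (int \<Rightarrow> complex) \<Rightarrow> ennreal" where
  "uap_of N A F = Inf {ennreal M | M. uap_rep N A F M}"

primrec uap_norm :: "nat \<Rightarrow> nat \<Rightarrow> (int \<Rightarrow> complex) \<Rightarrow> ennreal" where
  "uap_norm N 0 = (\<lambda>F. if \<exists>a. F = (\<lambda>_. a) then ennreal (Linf_norm_cyc N F) else \<infinity>)"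
| "uap_norm N (Suc d) = uap_of N (uap_norm N d)"

definition recurrence_bound :: "(nat \<Rightarrow> nat \<Rightarrow> real \<Rightarrow> real \<Rightarrow> real) \<Rightarrow> bool" where
  "recurrence_bound c0 \<longleftrightarrow>
     (\<forall>d k \<delta> M. k \<ge> 1 \<and> \<delta> > 0 \<and> M > 0 \<longrightarrow>
        c0 d k \<delta> M > 0 \<and>
        (\<forall>N fUperp fUAP. prime N \<and> fUperp \<in> unit_fun N \<and> fUAP \<in> unit_fun N \<and>
             L2_norm_cyc N (\<lambda>x. fUperp x - fUAP x) \<le> \<delta>\<^sup>2 / (1024 * real k) \<and>
             avg fUperp (cyc N) \<ge> \<delta> \<and>
             uap_norm N d (\<lambda>x. complex_of_real (fUAP x)) < ennreal M \<longrightarrow>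
           (\<forall>\<mu>\<in>cyc N. \<forall>N1\<ge>1.
              avg (\<lambda>(x, r). \<Prod>j<k. shift (\<mu> * int j * r) fUperp x) (cyc N \<times> {0..N1})
                \<ge> c0 d k \<delta> M)))"

end

theory Submission
  imports Defs
begin

text \<open>
  Among the functions \<open>g\<close> with values in \<open>[0, 1]\<close> and bounded uniform almost periodicity norm, consider
  the energy \<open>\<parallel>f - g\<parallel>\<^sub>2\<^sup>2\<close>. If \<open>f - g\<close> has a large Gowers norm, it correlates with its
  dual function \<open>D\<close>, which is uniformly almost periodic. Moving from \<open>g\<close> towards \<open>D\<close> and truncating to
  \<open>[0, 1]\<close> decreases the energy; replacing the truncation by a polynomial keeps the almost
  periodicity norm controlled, because the almost periodic functions form an algebra.

  Start from \<open>g\<close>, which fixes \<open>M\<close> and thus the Gowers norm threshold, and iterate until a function \<open>g'\<close>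
  with \<open>f - g'\<close> below this threshold is reached. If \<open>g'\<close> is close to \<open>g\<close>, then \<open>g'\<close>, with its mean
  corrected, and \<open>g\<close> are the structured and the almost periodic part. Otherwise the midpoint of \<open>g\<close> and
  \<open>g'\<close> has much less energy than \<open>g\<close>, by a fixed amount independent of the threshold, and one restarts
  from there.
\<close>

subsection \<open>Averages over the cyclic group\<close>

lemma card_cyc [simp]: "card (cyc N) = N"
  and finite_cyc [simp]: "finite (cyc N)"
  by (simp_all add: cyc_def)

lemma cyc_nonempty: "0 < N \<Longrightarrow> cyc N \<noteq> {}"
  by (simp add: cyc_def)

lemma mod_in_cyc: "0 < N \<Longrightarrow> x mod int N \<in> cyc N"
  by (simp add: cyc_def)

lemma cyc_fun_add: "f \<in> cyc_fun N \<Longrightarrow> f (x + int N) = f x"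
  by (simp add: cyc_fun_def)

lemma cyc_fun_add_mult:
  assumes "f \<in> cyc_fun N"
  shows "f (x + int N * m) = f x"
proof -
  have nat: "f (x + int N * int j) = f x" for x j
  proof (induction j)
    case (Suc j)
    have "f (x + int N * int (Suc j)) = f ((x + int N * int j) + int N)"
      by (simp add: algebra_simps)
    with Suc show ?case using cyc_fun_add[OF assms] by metis
  qed simp
  show ?thesis
  proof (cases "0 \<le> m")
    case True
    then show ?thesis using nat[of x "nat m"] by simp
  next
    case False
    then show ?thesis using nat[of "x + int N * m" "nat (- m)"] by (simp add: algebra_simps)
  qed
qed

lemma cyc_fun_mod: "f \<in> cyc_fun N \<Longrightarrow> f (x mod int N) = f x"
  using cyc_fun_add_mult[of f N "x mod int N" "x div int N"] by (simp add: mod_mult_div_eq)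

lemma cyc_fun_shift: "f \<in> cyc_fun N \<Longrightarrow> shift n f \<in> cyc_fun N"
  by (auto simp: cyc_fun_def shift_def algebra_simps) (metis add.commute add.left_commute)

lemma avg_cyc_shift:
  assumes "0 < N" "f \<in> cyc_fun N"
  shows "avg (\<lambda>x. f (x + n)) (cyc N) = avg f (cyc N)"
proof -
  have "(\<Sum>x\<in>cyc N. f (x + n)) = (\<Sum>x\<in>cyc N. f x)"
  \<comment> \<open>Translation followed by reduction modulo \<open>N\<close> permutes the
    representatives, and a periodic \<open>f\<close> does not see the reduction.\<close>
  proof (rule sum.reindex_bij_witness[where i = "\<lambda>x. (x - n) mod int N" and j = "\<lambda>x. (x + n) mod int N"])
    fix a assume "a \<in> cyc N"
    then show "((a + n) mod int N - n) mod int N = a" "((a - n) mod int N + n) mod int N = a"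
      by (simp_all add: cyc_def mod_diff_left_eq mod_add_left_eq)
    show "f ((a + n) mod int N) = f (a + n)" using cyc_fun_mod[OF assms(2)] .
  qed (use assms(1) mod_in_cyc in auto)
  then show ?thesis by (simp add: avg_def)
qed

lemma avg_add: "avg (\<lambda>x. f x + g x) A = avg f A + avg g A"
  by (simp add: avg_def sum.distrib add_divide_distrib)

lemma avg_diff: "avg (\<lambda>x. f x - g x) A = avg f A - avg g A"
  by (simp add: avg_def sum_subtractf diff_divide_distrib)

lemma avg_cmult: "avg (\<lambda>x. a * f x) A = a * avg f A"
  by (simp add: avg_def sum_distrib_left)

lemma avg_const: "finite A \<Longrightarrow> A \<noteq> {} \<Longrightarrow> avg (\<lambda>_. a) A = a"
  by (simp add: avg_def)

lemma avg_of_real: "avg (\<lambda>x. of_real (f x)) A = of_real (avg f A)"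
  by (simp add: avg_def)

lemma avg_mono:
  fixes f g :: "'i \<Rightarrow> real"
  assumes "\<And>x. x \<in> A \<Longrightarrow> f x \<le> g x"
  shows "avg f A \<le> avg g A"
  unfolding avg_def using assms by (intro divide_right_mono sum_mono) auto

lemma avg_swap: "avg (\<lambda>x. avg (\<lambda>y. f x y) B) A = avg (\<lambda>y. avg (\<lambda>x. f x y) A) B"
  unfolding avg_def sum_divide_distrib[symmetric] by (subst sum.swap) (simp add: field_simps)

lemma bounded_fun_iff:
  assumes "0 < N"
  shows "f \<in> bounded_fun N \<longleftrightarrow> f \<in> cyc_fun N \<and> (\<forall>x. norm (f x) \<le> 1)"
proof (cases "f \<in> cyc_fun N")
  case True
  have "Linf_norm_cyc N f \<le> 1 \<longleftrightarrow> (\<forall>x\<in>cyc N. norm (f x) \<le> 1)"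
    unfolding Linf_norm_cyc_def using cyc_nonempty[OF assms] by (subst cSUP_le_iff) auto
  also have "\<dots> \<longleftrightarrow> (\<forall>x. norm (f x) \<le> 1)"
    using cyc_fun_mod[OF True] mod_in_cyc[OF assms] by metis
  finally show ?thesis using True by (simp add: bounded_fun_def)
qed (simp add: bounded_fun_def)

subsection \<open>The algebra of uniformly almost periodic functions\<close>

text \<open>An unnormalised form of \<open>uap_rep\<close>: the weights absorb both the factor
  \<open>M\<close> and the law of the random variable, and the index type is free. Sums and products
  of representations then only need disjoint unions and products of index sets.\<close>

definition uap_data ::
    "nat \<Rightarrow> ((int \<Rightarrow> complex) \<Rightarrow> ennreal) \<Rightarrow> (int \<Rightarrow> complex) \<Rightarrow> real \<Rightarrow> 'i set \<Rightarrow> ('i \<Rightarrow> real) \<Rightarrow>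
      ('i \<Rightarrow> int \<Rightarrow> complex) \<Rightarrow> (int \<Rightarrow> 'i \<Rightarrow> int \<Rightarrow> complex) \<Rightarrow> bool" where
  "uap_data N A F M I w g c \<longleftrightarrow>
     F \<in> cyc_fun N \<and> finite I \<and> I \<noteq> {} \<and> (\<forall>i\<in>I. 0 \<le> w i) \<and> sum w I = M \<and>
     (\<forall>i\<in>I. g i \<in> bounded_fun N) \<and> (\<forall>n\<in>cyc N. \<forall>i\<in>I. c n i \<in> cyc_fun N \<and> A (c n i) \<le> 1) \<and>
     (\<forall>n\<in>cyc N. \<forall>x. F (x + n) = (\<Sum>i\<in>I. of_real (w i) * (c n i x * g i x)))"

lemma uap_dataD:
  assumes "uap_data N A F M I w g c"
  shows "F \<in> cyc_fun N" "finite I" "I \<noteq> {}" "\<And>i. i \<in> I \<Longrightarrow> 0 \<le> w i" "sum w I = M"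
    "\<And>i. i \<in> I \<Longrightarrow> g i \<in> bounded_fun N"
    "\<And>n i. n \<in> cyc N \<Longrightarrow> i \<in> I \<Longrightarrow> c n i \<in> cyc_fun N \<and> A (c n i) \<le> 1"
    "\<And>n x. n \<in> cyc N \<Longrightarrow> F (x + n) = (\<Sum>i\<in>I. of_real (w i) * (c n i x * g i x))"
  using assms by (auto simp: uap_data_def)

lemma uap_repI:
  fixes I :: "'i set"
  assumes F: "F \<in> cyc_fun N" and I: "finite I" "I \<noteq> {}"
    and w: "\<And>i. i \<in> I \<Longrightarrow> 0 \<le> w i" "sum w I = M"
    and g: "\<And>i. i \<in> I \<Longrightarrow> g i \<in> bounded_fun N"
    and c: "\<And>n i. n \<in> cyc N \<Longrightarrow> i \<in> I \<Longrightarrow> c n i \<in> cyc_fun N \<and> A (c n i) \<le> 1"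
    and eq: "\<And>n x. n \<in> cyc N \<Longrightarrow> F (x + n) = (\<Sum>i\<in>I. of_real (w i) * (c n i x * g i x))"
  shows "uap_rep N A F M"
proof -
  define e where "e = to_nat_on I"
  define d where "d = inv_into I e"
  have e: "inj_on e I" using I(1) unfolding e_def by (intro inj_on_to_nat_on countable_finite)
  have d: "d (e i) = i" if "i \<in> I" for i using e that by (simp add: d_def)
  have M: "0 \<le> M" using w sum_nonneg by metis
  obtain p where p: "set_pmf p \<subseteq> I" "\<And>i. i \<in> I \<Longrightarrow> M * pmf p i = w i"
  \<comment> \<open>Dividing the weights by their total gives the law. If the total is 0, all
    weights vanish and any point mass will do.\<close>
  proof (cases "M = 0")
    case True
    obtain i0 where "i0 \<in> I" using I by auto
    moreover have "w i = 0" if "i \<in> I" for i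
      using w True I that by (metis sum_nonneg_eq_0_iff)
    ultimately show ?thesis using True that[of "return_pmf i0"] by simp
  next
    case False
    define q where "q = (\<lambda>i. if i \<in> I then w i / M else 0)"
    have q0: "0 \<le> q i" for i using w M by (simp add: q_def)
    have "(\<integral>\<^sup>+ i. ennreal (q i) \<partial>count_space UNIV) = (\<Sum>i\<in>I. ennreal (q i))"
      by (rule nn_integral_count_space'[OF I(1)]) (auto simp: q_def)
    also have "\<dots> = ennreal (\<Sum>i\<in>I. w i / M)"
      using w M by (subst sum_ennreal) (auto simp: q_def cong: sum.cong)
    also have "\<dots> = 1" using False w by (simp add: sum_divide_distrib[symmetric])
    finally have pm: "pmf (embed_pmf q) i = q i" for i by (simp add: pmf_embed_pmf q0)
    show ?thesis
    proof (rule that[of "embed_pmf q"])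
      show "set_pmf (embed_pmf q) \<subseteq> I"
        using pm by (auto simp: set_pmf_iff q_def split: if_splits)
      show "M * pmf (embed_pmf q) i = w i" if "i \<in> I" for i
        using that False unfolding pm by (simp add: q_def)
    qed
  qed
  have "shift n F x = complex_of_real M *
      measure_pmf.expectation (map_pmf e p) (\<lambda>h. c n (d h) x * g (d h) x)" if "n \<in> cyc N" for n x
  proof -
    have "measure_pmf.expectation (map_pmf e p) (\<lambda>h. c n (d h) x * g (d h) x)
        = (\<Sum>i\<in>I. pmf p i *\<^sub>R (c n (d (e i)) x * g (d (e i)) x))"
      unfolding integral_map_pmf using p(1) by (intro integral_measure_pmf I) auto
    then have "complex_of_real M * measure_pmf.expectation (map_pmf e p) (\<lambda>h. c n (d h) x * g (d h) x)
        = (\<Sum>i\<in>I. complex_of_real (M * pmf p i) * (c n i x * g i x))"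
      by (simp add: sum_distrib_left d scaleR_conv_of_real mult.assoc)
    then show ?thesis using p(2) eq[OF that] by (simp add: shift_def)
  qed
  then show ?thesis
    unfolding uap_rep_def using F M I p(1) g c d
    by (intro conjI exI[of _ "e ` I"] exI[of _ "map_pmf e p"] exI[of _ "g \<circ> d"] exI[of _ "\<lambda>n. c n \<circ> d"])
      auto
qed

lemma uap_repE:
  assumes "uap_rep N A F M"
  obtains H :: "nat set" and w g c where "uap_data N A F M H w g c"
proof -
  from assms obtain H :: "nat set" and p g c where F: "F \<in> cyc_fun N" "0 \<le> M" "finite H" "H \<noteq> {}"
      "set_pmf p \<subseteq> H" "\<forall>h\<in>H. g h \<in> bounded_fun N"
      "\<forall>n\<in>cyc N. \<forall>h\<in>H. c n h \<in> cyc_fun N \<and> A (c n h) \<le> 1"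
      "\<forall>n\<in>cyc N. \<forall>x. shift n F x =
         complex_of_real M * measure_pmf.expectation p (\<lambda>h. c n h x * g h x)"
    unfolding uap_rep_def by blast
  have "measure_pmf.expectation p (\<lambda>h. c n h x * g h x) = (\<Sum>i\<in>H. pmf p i *\<^sub>R (c n i x * g i x))" for n x
    using F by (intro integral_measure_pmf) auto
  then have eq: "F (x + n) = (\<Sum>i\<in>H. of_real (M * pmf p i) * (c n i x * g i x))" if "n \<in> cyc N" for n x
    using F(8) that by (simp add: shift_def sum_distrib_left scaleR_conv_of_real mult.assoc)
  have "(\<Sum>i\<in>H. M * pmf p i) = M"
    using sum_pmf_eq_1[OF F(3,5)] by (simp add: sum_distrib_left[symmetric])
  then show ?thesis
    using that[of H "\<lambda>i. M * pmf p i" g c] F eq by (simp add: uap_data_def)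
qed

lemma uap_rep_nonneg: "uap_rep N A F M \<Longrightarrow> 0 \<le> M"
  by (simp add: uap_rep_def)

text \<open>Translating by \<open>n\<close> after \<open>m\<close> is translating by
  \<open>n + m\<close>, so \<open>g\<close> and the weights stay and only the coefficients are
  relabelled. The label is reduced modulo \<open>N\<close> because coefficients are controlled on
  \<open>cyc N\<close> only.\<close>

lemma uap_rep_shift:
  assumes "0 < N" "uap_rep N A F M"
  shows "uap_rep N A (shift m F) M"
proof -
  obtain H :: "nat set" and w g c where "uap_data N A F M H w g c"
    using assms(2) by (rule uap_repE)
  note H = uap_dataD[OF this]
  have r: "(n + m) mod int N \<in> cyc N" for n using mod_in_cyc[OF assms(1)] .
  show ?thesis
  proof (rule uap_repI[where I = H and w = w and g = g and c = "\<lambda>n. c ((n + m) mod int N)"])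
    fix n x
    have "shift m F (x + n) = F ((x + (n + m)) mod int N)"
      by (simp add: shift_def cyc_fun_mod[OF H(1)] add.assoc)
    also have "\<dots> = F ((x + (n + m) mod int N) mod int N)"
      by (simp add: mod_add_right_eq)
    also have "\<dots> = F (x + (n + m) mod int N)" by (rule cyc_fun_mod[OF H(1)])
    finally show "shift m F (x + n) = (\<Sum>i\<in>H. of_real (w i) * (c ((n + m) mod int N) i x * g i x))"
      using H(8)[OF r] by simp
  qed (use H r cyc_fun_shift[OF H(1)] in auto)
qed

lemma uap_rep_const:
  assumes "0 < N" "A (\<lambda>_. 1) \<le> 1" "cmod a \<le> M"
  shows "uap_rep N A (\<lambda>_. a) M"
proof -
  have 0: "0 \<le> M" using assms(3) norm_ge_zero order_trans by blast
  have "cmod (a / of_real M) \<le> 1"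
    using 0 assms(3) by (cases "M = 0") (auto simp: norm_divide)
  moreover have "of_real M * (a / of_real M) = a" using assms(3) by (cases "M = 0") auto
  ultimately show ?thesis
    using assms 0 by (intro uap_repI[where I = "{()}" and w = "\<lambda>_. M" and c = "\<lambda>_ _ _. 1"
          and g = "\<lambda>_ _. a / of_real M"])
      (auto simp: cyc_fun_def bounded_fun_iff)
qed

lemma uap_rep_add:
  assumes "uap_rep N A F M" "uap_rep N A F' M'"
  shows "uap_rep N A (\<lambda>x. F x + F' x) (M + M')"
proof -
  obtain H :: "nat set" and w g c where "uap_data N A F M H w g c"
    using assms(1) by (rule uap_repE)
  note H = uap_dataD[OF this]
  obtain H' :: "nat set" and w' g' c' where "uap_data N A F' M' H' w' g' c'"
    using assms(2) by (rule uap_repE)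
  note H' = uap_dataD[OF this]
  show ?thesis
    by (rule uap_repI[where I = "H <+> H'" and w = "case_sum w w'" and g = "case_sum g g'"
          and c = "\<lambda>n. case_sum (c n) (c' n)"])
      (use H H' in \<open>auto simp: sum.Plus cyc_fun_def\<close>)
qed

lemma uap_rep_mono:
  assumes "0 < N" "A (\<lambda>_. 1) \<le> 1" "uap_rep N A F M" "M \<le> M'"
  shows "uap_rep N A F M'"
proof -
  have "uap_rep N A (\<lambda>_. 0) (M' - M)"
    using assms by (intro uap_rep_const) auto
  with uap_rep_add[OF assms(3) this] show ?thesis by simp
qed

section \<open>Products, and the unit ball at every order\<close>

definition mult_closed_ball :: "((int \<Rightarrow> complex) \<Rightarrow> ennreal) \<Rightarrow> bool" where
  "mult_closed_ball A \<longleftrightarrow> A (\<lambda>_. 1) \<le> 1 \<and>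
     (\<forall>F G. A F \<le> 1 \<and> A G \<le> 1 \<longrightarrow> A (\<lambda>x. F x * G x) \<le> 1)"

text \<open>Expanding the product of the two weighted sums gives a sum over pairs. The bounded
  factors multiply to bounded functions and the coefficients stay in the unit ball of
  \<open>A\<close>. Closure of that ball under products is therefore the invariant to carry from
  order to order.\<close>

lemma uap_rep_mult:
  assumes "0 < N" "mult_closed_ball A" "uap_rep N A F M" "uap_rep N A F' M'"
  shows "uap_rep N A (\<lambda>x. F x * F' x) (M * M')"
proof -
  obtain H :: "nat set" and w g c where "uap_data N A F M H w g c"
    using assms(3) by (rule uap_repE)
  note H = uap_dataD[OF this]
  obtain H' :: "nat set" and w' g' c' where "uap_data N A F' M' H' w' g' c'"
    using assms(4) by (rule uap_repE)
  note H' = uap_dataD[OF this]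
  show ?thesis
  proof (rule uap_repI[where I = "H \<times> H'" and w = "\<lambda>(i, j). w i * w' j"
        and g = "\<lambda>(i, j) x. g i x * g' j x" and c = "\<lambda>n (i, j) x. c n i x * c' n j x"])
    show "(\<Sum>(i, j)\<in>H \<times> H'. w i * w' j) = M * M'"
      unfolding H(5)[symmetric] H'(5)[symmetric] sum_product sum.cartesian_product ..
    fix n x assume n: "n \<in> cyc N"
    show "F (x + n) * F' (x + n) = (\<Sum>i\<in>H \<times> H'. of_real (case i of (i, j) \<Rightarrow> w i * w' j) *
        ((case i of (i, j) \<Rightarrow> \<lambda>x. c n i x * c' n j x) x * (case i of (i, j) \<Rightarrow> \<lambda>x. g i x * g' j x) x))"
      unfolding H(8)[OF n] H'(8)[OF n] sum_product sum.cartesian_product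
      by (rule sum.cong) (auto simp: algebra_simps)
  next
    fix i assume "i \<in> H \<times> H'"
    then show "(case i of (i, j) \<Rightarrow> \<lambda>x. g i x * g' j x) \<in> bounded_fun N"
      using H(6) H'(6) by (auto simp: bounded_fun_iff[OF assms(1)] cyc_fun_def norm_mult mult_le_one)
  qed (use H H' assms(2) in \<open>auto simp: cyc_fun_def mult_closed_ball_def\<close>)
qed

lemma uap_rep_imp_uap_of_le: "uap_rep N A F M \<Longrightarrow> uap_of N A F \<le> ennreal M"
  unfolding uap_of_def by (rule Inf_lower) blast

lemma uap_of_leD:
  assumes "uap_of N A F \<le> 1" "0 < e"
  obtains M where "uap_rep N A F M" "M < 1 + e"
proof -
  have "(1::ennreal) < ennreal (1 + e)"
    using ennreal_less_iff[of 1 "1 + e"] assms(2) by simp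
  with assms(1) have "uap_of N A F < ennreal (1 + e)" by (rule le_less_trans)
  then obtain M where "uap_rep N A F M" "ennreal M < ennreal (1 + e)"
    unfolding uap_of_def Inf_less_iff by blast
  then show ?thesis using that by (simp add: ennreal_less_iff uap_rep_nonneg)
qed

lemma mult_closed_ball_uap_of:
  assumes N: "0 < N" and A: "mult_closed_ball A"
  shows "mult_closed_ball (uap_of N A)"
  unfolding mult_closed_ball_def
proof (intro conjI allI impI)
  show "uap_of N A (\<lambda>_. 1) \<le> 1"
    using uap_rep_imp_uap_of_le[OF uap_rep_const[OF N, of A 1 1]] A by (simp add: mult_closed_ball_def)
  fix F G assume "uap_of N A F \<le> 1 \<and> uap_of N A G \<le> 1"
  then have F: "uap_of N A F \<le> 1" and G: "uap_of N A G \<le> 1" by auto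
  show "uap_of N A (\<lambda>x. F x * G x) \<le> 1"
  proof (rule ennreal_le_epsilon)
    fix e :: real assume e: "0 < e"
    \<comment> \<open>The infimum need not be attained, so the representations used may have mass
      slightly above 1. The cap at 1 gives \<open>\<epsilon> * \<epsilon> \<le> \<epsilon>\<close>,
      which bounds the product of the masses by \<open>1 + 3 * \<epsilon>\<close>.\<close>
    define \<epsilon> where "\<epsilon> = min 1 (e / 3)"
    have \<epsilon>: "0 < \<epsilon>" "\<epsilon> \<le> 1" "3 * \<epsilon> \<le> e" using e by (auto simp: \<epsilon>_def)
    obtain M where M: "uap_rep N A F M" "M < 1 + \<epsilon>" using uap_of_leD[OF F \<epsilon>(1)] .
    obtain M' where M': "uap_rep N A G M'" "M' < 1 + \<epsilon>" using uap_of_leD[OF G \<epsilon>(1)] .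
    have "M * M' \<le> (1 + \<epsilon>) * (1 + \<epsilon>)"
      using M M' \<epsilon> by (intro mult_mono) (auto simp: uap_rep_nonneg)
    also have "\<dots> \<le> 1 + 3 * \<epsilon>" using \<epsilon> by (simp add: algebra_simps)
    finally have "M * M' \<le> 1 + e" using \<epsilon> by simp
    then have "ennreal (M * M') \<le> 1 + ennreal e"
      using e by (metis ennreal_1 ennreal_leI ennreal_plus less_imp_le zero_le_one)
    with uap_rep_imp_uap_of_le[OF uap_rep_mult[OF N A M(1) M'(1)]]
    show "uap_of N A (\<lambda>x. F x * G x) \<le> 1 + ennreal e" by (rule order_trans)
  qed
qed

lemma uap_norm_0_const:
  assumes "0 < N"
  shows "uap_norm N 0 (\<lambda>_. a) = ennreal (cmod a)"
  using cyc_nonempty[OF assms] by (auto simp: Linf_norm_cyc_def)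

lemma mult_closed_ball_uap_norm:
  assumes N: "0 < N"
  shows "mult_closed_ball (uap_norm N d)"
proof (induction d)
  case 0
  \<comment> \<open>At order zero only constants have finite norm, so the unit ball is the closed
    unit disc.\<close>
  have *: "\<exists>a. F = (\<lambda>_. a) \<and> cmod a \<le> 1" if "uap_norm N 0 F \<le> 1" for F
  proof -
    have "\<exists>a. F = (\<lambda>_. a)" by (rule ccontr) (use that in \<open>simp add: top_unique\<close>)
    then obtain a where a: "F = (\<lambda>_. a)" by blast
    with that have "ennreal (cmod a) \<le> 1" by (simp only: uap_norm_0_const[OF N])
    with a show ?thesis by (auto simp: ennreal_le_1)
  qed
  have "uap_norm N 0 (\<lambda>x. F x * G x) \<le> 1" if FG: "uap_norm N 0 F \<le> 1 \<and> uap_norm N 0 G \<le> 1" for F G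
  proof -
    obtain a b where "F = (\<lambda>_. a)" "cmod a \<le> 1" "G = (\<lambda>_. b)" "cmod b \<le> 1" using FG *[of F] *[of G] by blast
    then show ?thesis
      by (simp only: uap_norm_0_const[OF N]) (simp add: ennreal_le_1 norm_mult mult_le_one)
  qed
  moreover have "uap_norm N 0 (\<lambda>_. 1) \<le> 1" unfolding uap_norm_0_const[OF N] by simp
  ultimately show ?case by (auto simp only: mult_closed_ball_def)
next
  case (Suc d)
  then show ?case using mult_closed_ball_uap_of[OF N] by simp
qed

lemma uap_norm_const_1: "0 < N \<Longrightarrow> uap_norm N d (\<lambda>_. 1) \<le> 1"
  using mult_closed_ball_uap_norm by (simp add: mult_closed_ball_def)

lemma uap_norm_shift_le:
  assumes N: "0 < N" and F: "uap_norm N d F \<le> 1"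
  shows "uap_norm N d (shift n F) \<le> 1"
proof (cases d)
  case 0
  have "\<exists>a. F = (\<lambda>_. a)" by (rule ccontr) (use F 0 in \<open>simp add: top_unique\<close>)
  then have "shift n F = F" by (auto simp: shift_def)
  then show ?thesis using F by simp
next
  case (Suc e)
  have "uap_of N (uap_norm N e) (shift n F) \<le> uap_of N (uap_norm N e) F"
    unfolding uap_of_def by (rule Inf_superset_mono) (use uap_rep_shift[OF N] in blast)
  then show ?thesis using F Suc by simp
qed

subsection \<open>Dual functions\<close>

text \<open>
  For real-valued functions the conjugations in the Gowers norm disappear, and peeling off one
  factor \<open>f x\<close> from the \<open>2 ^ d\<close>-fold average that it expands to leaves the following function.
\<close>

fun dual_fun :: "nat \<Rightarrow> nat \<Rightarrow> (int \<Rightarrow> real) \<Rightarrow> int \<Rightarrow> real" where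
  "dual_fun N 0 f = (\<lambda>_. 1)"
| "dual_fun N (Suc d) f =
     (\<lambda>x. avg (\<lambda>h. f (x + h) * dual_fun N d (\<lambda>y. f y * f (y + h)) x) (cyc N))"

lemma cyc_fun_mult_shift:
  fixes f :: "int \<Rightarrow> real"
  assumes "f \<in> cyc_fun N"
  shows "(\<lambda>y. f y * f (y + h)) \<in> cyc_fun N"
  using assms cyc_fun_shift[OF assms, of h] by (auto simp: cyc_fun_def shift_def)

lemma dual_fun_cyc_fun: "f \<in> cyc_fun N \<Longrightarrow> dual_fun N d f \<in> cyc_fun N"
proof (induction d arbitrary: f)
  case (Suc d)
  have "f (x + int N + h) = f (x + h)" for x h
    using cyc_fun_add[OF cyc_fun_shift[OF Suc.prems]] by (simp add: shift_def)
  moreover have "dual_fun N d (\<lambda>y. f y * f (y + h)) (x + int N) = dual_fun N d (\<lambda>y. f y * f (y + h)) x" for x h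
    by (rule cyc_fun_add[OF Suc.IH[OF cyc_fun_mult_shift[OF Suc.prems]]])
  ultimately show ?case by (simp add: cyc_fun_def)
qed (simp add: cyc_fun_def)

lemma abs_avg_le_1:
  fixes f :: "'i \<Rightarrow> real"
  assumes "\<And>x. x \<in> A \<Longrightarrow> \<bar>f x\<bar> \<le> 1"
  shows "\<bar>avg f A\<bar> \<le> 1"
proof -
  have "\<bar>sum f A\<bar> \<le> (\<Sum>x\<in>A. \<bar>f x\<bar>)" by (rule sum_abs)
  also have "\<dots> \<le> of_nat (card A) * 1" by (rule sum_bounded_above) (rule assms)
  finally show ?thesis by (cases "card A = 0") (auto simp: avg_def abs_divide divide_le_eq)
qed

lemma abs_dual_fun_le_1: "(\<And>x. \<bar>f x\<bar> \<le> 1) \<Longrightarrow> \<bar>dual_fun N d f x\<bar> \<le> 1"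
proof (induction d arbitrary: f x)
  case (Suc d)
  have "\<bar>f y * f (y + h)\<bar> \<le> 1" for y h
    unfolding abs_mult by (rule mult_le_one) (use Suc.prems in auto)
  then have "\<bar>dual_fun N d (\<lambda>y. f y * f (y + h)) x\<bar> \<le> 1" for h by (rule Suc.IH)
  then have "\<bar>f (x + h) * dual_fun N d (\<lambda>y. f y * f (y + h)) x\<bar> \<le> 1" for h
    unfolding abs_mult by (intro mult_le_one) (use Suc.prems in auto)
  then show ?case unfolding dual_fun.simps by (rule abs_avg_le_1)
qed simp

text \<open>Swapping the averages over \<open>h\<close> and \<open>x\<close> lets the factor
  \<open>f x\<close> be pulled out. Taking the power undoes the root only if the average under it is
  nonnegative, so nonnegativity is proved in the same induction.\<close>

lemma gowers_dual_fun:
  assumes N: "0 < N"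
  shows "f \<in> cyc_fun N \<Longrightarrow>
    gowers N d (\<lambda>x. of_real (f x)) ^ (2 ^ d) = of_real (avg (\<lambda>x. f x * dual_fun N d f x) (cyc N)) \<and>
    (0 < d \<longrightarrow> (\<exists>r\<ge>0. gowers N d (\<lambda>x. of_real (f x)) = of_real r))"
proof (induction d arbitrary: f)
  case 0
  show ?case by (simp add: avg_of_real)
next
  case (Suc d)
  define G where "G = (\<lambda>h y. f y * f (y + h))"
  define P where "P = (\<lambda>h. avg (\<lambda>x. G h x * dual_fun N d (G h) x) (cyc N))"
  have G: "G h \<in> cyc_fun N" for h unfolding G_def by (rule cyc_fun_mult_shift[OF Suc.prems])
  have eq: "(\<lambda>x. cnj (of_real (f x)) * shift h (\<lambda>x. complex_of_real (f x)) x) = (\<lambda>x. of_real (G h x))" for h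
    by (simp add: shift_def G_def)
  have P: "gowers N d (\<lambda>x. of_real (G h x)) ^ (2 ^ d) = of_real (P h)" for h
    using Suc.IH[OF G] by (simp add: P_def)
  have avgP: "avg P (cyc N) = avg (\<lambda>x. f x * dual_fun N (Suc d) f x) (cyc N)"
  proof -
    have "avg P (cyc N) = avg (\<lambda>x. avg (\<lambda>h. G h x * dual_fun N d (G h) x) (cyc N)) (cyc N)"
      unfolding P_def by (rule avg_swap)
    then show ?thesis by (simp add: G_def avg_cmult[symmetric] mult.assoc)
  qed
  have "0 \<le> avg P (cyc N)"
  \<comment> \<open>At order one the individual \<open>P h\<close> may be negative; their average is
    the square of the mean of \<open>f\<close>. At higher order each \<open>P h\<close> is itself a
    power of a nonnegative number.\<close>
  proof (cases "d = 0")
    case True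
    have "avg P (cyc N) = avg (\<lambda>x. f x * avg (\<lambda>h. f (h + x)) (cyc N)) (cyc N)"
      unfolding avgP using True by (simp add: add.commute)
    also have "\<dots> = avg f (cyc N) * avg f (cyc N)"
      unfolding avg_cyc_shift[OF N Suc.prems] by (simp add: avg_def sum_divide_distrib[symmetric] sum_distrib_right[symmetric])
    finally show ?thesis by simp
  next
    case False
    have "0 \<le> P h" for h
    proof -
      obtain r where "0 \<le> r" "gowers N d (\<lambda>x. of_real (G h x)) = of_real r"
        using Suc.IH[OF G] False by auto
      then have "of_real (P h) = complex_of_real (r ^ 2 ^ d)" using P[of h] by simp
      then have "P h = r ^ 2 ^ d" by (simp only: of_real_eq_iff)
      then show ?thesis using \<open>0 \<le> r\<close> by simp
    qed
    then show ?thesis by (simp add: avg_def sum_nonneg)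
  qed
  moreover have "gowers N (Suc d) (\<lambda>x. of_real (f x)) = of_real (root (2 ^ Suc d) (avg P (cyc N)))"
    by (simp only: gowers.simps eq P avg_of_real) simp
  ultimately show ?case
    unfolding avgP[symmetric] by (auto simp del: gowers.simps simp flip: of_real_power)
qed

lemma gowers_norm_dual_fun:
  assumes "0 < N" "f \<in> cyc_fun N"
  shows "0 \<le> gowers_norm N (Suc d) (\<lambda>x. of_real (f x))"
    and "gowers_norm N (Suc d) (\<lambda>x. of_real (f x)) ^ (2 ^ Suc d) =
      avg (\<lambda>x. f x * dual_fun N (Suc d) f x) (cyc N)"
proof -
  obtain r where r: "0 \<le> r" "gowers N (Suc d) (\<lambda>x. of_real (f x)) = of_real r"
    using gowers_dual_fun[OF assms, of "Suc d"] by (auto simp del: gowers.simps)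
  then show "0 \<le> gowers_norm N (Suc d) (\<lambda>x. of_real (f x))" by (simp add: gowers_norm_def del: gowers.simps)
  have "complex_of_real (r ^ 2 ^ Suc d) = of_real (avg (\<lambda>x. f x * dual_fun N (Suc d) f x) (cyc N))"
    using gowers_dual_fun[OF assms, of "Suc d"] r(2) by (simp only: of_real_power)
  then show "gowers_norm N (Suc d) (\<lambda>x. of_real (f x)) ^ (2 ^ Suc d) =
      avg (\<lambda>x. f x * dual_fun N (Suc d) f x) (cyc N)"
    using r(2) by (simp only: of_real_eq_iff gowers_norm_def Re_complex_of_real)
qed

text \<open>In the average over \<open>h\<close> that defines the dual function at
  \<open>x + n\<close>, replace \<open>h\<close> by \<open>h - n\<close>. The factor
  \<open>f (x + h)\<close> no longer involves \<open>n\<close> and serves as the bounded function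
  with index \<open>h\<close>; the remaining factor, a translated dual function of one order less,
  is the coefficient. The law is uniform on \<open>cyc N\<close>.\<close>

lemma uap_rep_dual_fun_step:
  assumes N: "0 < N" and f: "f \<in> cyc_fun N" "\<And>x. \<bar>f x\<bar> \<le> 1"
    and d: "\<And>G. G \<in> cyc_fun N \<Longrightarrow> (\<And>x. \<bar>G x\<bar> \<le> 1) \<Longrightarrow>
      uap_norm N d (\<lambda>x. of_real (dual_fun N (Suc d) G x)) \<le> 1"
  shows "uap_rep N (uap_norm N d) (\<lambda>x. of_real (dual_fun N (Suc (Suc d)) f x)) 1"
proof -
  define G where "G = (\<lambda>h y. f y * f (y + h))"
  define D where "D = (\<lambda>h x. dual_fun N (Suc d) (G h) x)"
  have G: "G h \<in> cyc_fun N" for h unfolding G_def by (rule cyc_fun_mult_shift[OF f(1)])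
  have "\<bar>G h y\<bar> \<le> 1" for h y
    unfolding abs_mult G_def by (rule mult_le_one) (use f in auto)
  then have D1: "uap_norm N d (\<lambda>x. of_real (D h x)) \<le> 1" for h
    unfolding D_def by (intro d G)
  have Dc: "(\<lambda>x. complex_of_real (D h x)) \<in> cyc_fun N" for h
    using dual_fun_cyc_fun[OF G[of h], of "Suc d"] by (auto simp: D_def cyc_fun_def simp del: dual_fun.simps)
  have fc: "(\<lambda>x. complex_of_real (f x)) \<in> cyc_fun N" using f(1) by (simp add: cyc_fun_def)
  show ?thesis
  proof (rule uap_repI[where I = "cyc N" and w = "\<lambda>_. 1 / real N"
        and g = "\<lambda>h. shift h (\<lambda>x. of_real (f x))" and c = "\<lambda>n h. shift n (\<lambda>x. of_real (D (h - n) x))"])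
    show "(\<lambda>x. complex_of_real (dual_fun N (Suc (Suc d)) f x)) \<in> cyc_fun N"
      using dual_fun_cyc_fun[OF f(1), of "Suc (Suc d)"] by (simp add: cyc_fun_def del: dual_fun.simps)
    show "shift h (\<lambda>x. complex_of_real (f x)) \<in> bounded_fun N" for h
      unfolding bounded_fun_iff[OF N] using cyc_fun_shift[OF fc] f(2) by (simp add: shift_def)
    show "shift n (\<lambda>x. complex_of_real (D (h - n) x)) \<in> cyc_fun N \<and>
        uap_norm N d (shift n (\<lambda>x. complex_of_real (D (h - n) x))) \<le> 1" for n h
      using cyc_fun_shift[OF Dc] uap_norm_shift_le[OF N D1] by blast
    fix n x
    have "(\<lambda>h. f (x + n + h) * D h (x + n)) \<in> cyc_fun N"
    proof -
      have "f (y + (h + int N)) = f (y + h)" for y h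
        using cyc_fun_add[OF f(1), of "y + h"] by (simp add: add.assoc)
      then show ?thesis by (simp add: cyc_fun_def D_def G_def del: dual_fun.simps)
    qed
    from avg_cyc_shift[OF N this, of "- n"]
    have "dual_fun N (Suc (Suc d)) f (x + n) = avg (\<lambda>h. f (x + h) * D (h - n) (x + n)) (cyc N)"
      by (simp add: D_def G_def)
    then show "complex_of_real (dual_fun N (Suc (Suc d)) f (x + n)) =
        (\<Sum>h\<in>cyc N. of_real (1 / real N) *
          (shift n (\<lambda>x. of_real (D (h - n) x)) x * shift h (\<lambda>x. of_real (f x)) x))"
      by (simp add: avg_def shift_def sum_divide_distrib mult.commute del: dual_fun.simps)
  qed (use N cyc_nonempty in auto)
qed

text \<open>The dual function of order one is the constant mean of \<open>f\<close>, so it belongs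
  to order zero of almost periodicity; this accounts for the offset between the two orders.\<close>

lemma uap_norm_dual_fun:
  assumes N: "0 < N"
  shows "f \<in> cyc_fun N \<Longrightarrow> (\<And>x. \<bar>f x\<bar> \<le> 1) \<Longrightarrow>
    uap_norm N d (\<lambda>x. of_real (dual_fun N (Suc d) f x)) \<le> 1"
proof (induction d arbitrary: f)
  case 0
  have "dual_fun N (Suc 0) f x = avg f (cyc N)" for x
    using avg_cyc_shift[OF N 0(1), of x] by (simp add: add.commute)
  moreover have "\<bar>avg f (cyc N)\<bar> \<le> 1" using 0(2) by (rule abs_avg_le_1)
  ultimately show ?case by (simp add: uap_norm_0_const[OF N] ennreal_le_1 del: dual_fun.simps uap_norm.simps)
next
  case (Suc d)
  have "uap_rep N (uap_norm N d) (\<lambda>x. of_real (dual_fun N (Suc (Suc d)) f x)) 1"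
    by (rule uap_rep_dual_fun_step[OF N Suc.prems Suc.IH])
  from uap_rep_imp_uap_of_le[OF this] show ?case by (simp del: dual_fun.simps)
qed

lemma uap_rep_dual_fun:
  assumes "0 < N" "f \<in> cyc_fun N" "\<And>x. \<bar>f x\<bar> \<le> 1"
  shows "uap_rep N (uap_norm N d) (\<lambda>x. of_real (dual_fun N (Suc (Suc d)) f x)) 1"
  using assms by (intro uap_rep_dual_fun_step uap_norm_dual_fun)

subsection \<open>Energy decrement\<close>

definition poly_bound :: "(real \<Rightarrow> real) \<Rightarrow> real \<Rightarrow> real \<Rightarrow> bool" where
  "poly_bound p R R' \<longleftrightarrow>
     (\<forall>N A g. 0 < N \<and> mult_closed_ball A \<and> uap_rep N A (\<lambda>x. of_real (g x)) R \<longrightarrow>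
        uap_rep N A (\<lambda>x. of_real (p (g x))) R')"

text \<open>Polynomials arise from linear and constant functions by sums and products, for which the
  masses add and multiply. The bound depends on \<open>p\<close> and \<open>R\<close> only, which is
  the source of the uniformity in \<open>N\<close> of all later constants.\<close>

lemma uap_rep_polynomial:
  assumes "real_polynomial_function p"
  shows "\<exists>R'. poly_bound p R R'"
  using assms
proof (induction p rule: real_polynomial_function.induct)
  case (linear p)
  have p: "p x = p 1 * x" for x
    using linear_scale[OF bounded_linear.linear[OF linear], of x 1] by simp
  have "uap_rep N A (\<lambda>x. of_real (p (g x))) (\<bar>p 1\<bar> * R)"
    if N: "0 < N" and A: "mult_closed_ball A" and g: "uap_rep N A (\<lambda>x. of_real (g x)) R" for N A g
  proof -
    have "uap_rep N A (\<lambda>_. of_real (p 1)) \<bar>p 1\<bar>"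
      using N A by (intro uap_rep_const) (auto simp: mult_closed_ball_def)
    moreover have "complex_of_real (p (g x)) = of_real (p 1) * of_real (g x)" for x
      unfolding p[of "g x"] by (rule of_real_mult)
    ultimately show ?thesis using uap_rep_mult[OF N A _ g] by presburger
  qed
  then show ?case unfolding poly_bound_def by blast
next
  case (const c)
  have "uap_rep N A (\<lambda>x. of_real c) \<bar>c\<bar>" if "0 < N" "mult_closed_ball A" for N A
    using that by (intro uap_rep_const) (auto simp: mult_closed_ball_def)
  then show ?case unfolding poly_bound_def by blast
next
  case (add p q)
  then obtain R1 R2 where R: "poly_bound p R R1" "poly_bound q R R2" by blast
  have "uap_rep N A (\<lambda>x. of_real (p (g x) + q (g x))) (R1 + R2)"
    if "0 < N" "mult_closed_ball A" "uap_rep N A (\<lambda>x. of_real (g x)) R" for N A g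
    unfolding of_real_add using R that unfolding poly_bound_def by (intro uap_rep_add) auto
  then show ?case unfolding poly_bound_def by blast
next
  case (mult p q)
  then obtain R1 R2 where R: "poly_bound p R R1" "poly_bound q R R2" by blast
  have "uap_rep N A (\<lambda>x. of_real (p (g x) * q (g x))) (R1 * R2)"
    if "0 < N" "mult_closed_ball A" "uap_rep N A (\<lambda>x. of_real (g x)) R" for N A g
    unfolding of_real_mult using R that unfolding poly_bound_def by (intro uap_rep_mult) auto
  then show ?case unfolding poly_bound_def by blast
qed

text \<open>Polynomials, unlike the truncation itself, are covered by
  \<open>uap_rep_polynomial\<close>. The approximant has to stay exactly within
  \<open>[0, 1]\<close>, because it is to produce members of \<open>unit_fun\<close>.\<close>

lemma polynomial_approximates_truncation:
  fixes a b e :: real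
  assumes "0 < e"
  obtains p where "real_polynomial_function p" "\<And>u. u \<in> {a..b} \<Longrightarrow> 0 \<le> p u \<and> p u \<le> 1"
    "\<And>u. u \<in> {a..b} \<Longrightarrow> \<bar>p u - max 0 (min 1 u)\<bar> \<le> e"
proof -
  define s where "s = min (1/2) (e / 2)"
  have s: "0 < s" "s \<le> 1/2" "2 * s \<le> e" using assms by (auto simp: s_def)
  \<comment> \<open>The truncation is first moved into \<open>{s..1 - s}\<close>, to leave room for the error.\<close>
  define q where "q = (\<lambda>u::real. s + (1 - 2 * s) * max 0 (min 1 u))"
  have "continuous_on {a..b} q" unfolding q_def by (intro continuous_intros)
  then obtain p where p: "real_polynomial_function p" "\<And>u. u \<in> {a..b} \<Longrightarrow> \<bar>q u - p u\<bar> < s"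
    using Stone_Weierstrass_real_polynomial_function[of "{a..b}" q s] s by auto
  show ?thesis
  proof (rule that[OF p(1)])
    fix u assume u: "u \<in> {a..b}"
    define v where "v = max 0 (min 1 u)"
    have v: "0 \<le> v" "v \<le> 1" by (auto simp: v_def)
    have "(1 - 2 * s) * v \<le> (1 - 2 * s) * 1" "0 \<le> (1 - 2 * s) * v"
      using v s by (intro mult_left_mono mult_nonneg_nonneg; simp)+
    with p(2)[OF u] show "0 \<le> p u \<and> p u \<le> 1" by (auto simp: q_def v_def[symmetric])
    have "\<bar>q u - v\<bar> \<le> s"
    proof -
      have "q u - v = s * (1 - 2 * v)" by (simp add: q_def v_def algebra_simps)
      moreover have "\<bar>1 - 2 * v\<bar> \<le> 1" using v by auto
      ultimately show ?thesis using s by (simp add: abs_mult mult_left_le)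
    qed
    with p(2)[OF u] s(3) show "\<bar>p u - max 0 (min 1 u)\<bar> \<le> e"
      unfolding v_def[symmetric] by linarith
  qed
qed

section \<open>A single energy decrement\<close>

definition uap_unit :: "nat \<Rightarrow> ((int \<Rightarrow> complex) \<Rightarrow> ennreal) \<Rightarrow> real \<Rightarrow> (int \<Rightarrow> real) set" where
  "uap_unit N A R = {g \<in> unit_fun N. uap_rep N A (\<lambda>x. of_real (g x)) R}"

text \<open>Two test functions matter later: the constant 1, which controls the mean, and the dual
  function, which controls the Gowers norm.\<close>

definition uap_test :: "nat \<Rightarrow> ((int \<Rightarrow> complex) \<Rightarrow> ennreal) \<Rightarrow> (int \<Rightarrow> real) set" where
  "uap_test N A = {\<phi>. uap_rep N A (\<lambda>x. of_real (\<phi> x)) 1 \<and> (\<forall>x. \<bar>\<phi> x\<bar> \<le> 1)}"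

definition sq_dist :: "nat \<Rightarrow> (int \<Rightarrow> real) \<Rightarrow> (int \<Rightarrow> real) \<Rightarrow> real" where
  "sq_dist N f g = avg (\<lambda>x. (f x - g x)\<^sup>2) (cyc N)"

lemma sq_dist_nonneg: "0 \<le> sq_dist N f g"
  by (simp add: sq_dist_def avg_def sum_nonneg)

definition decrement_bound :: "real \<Rightarrow> real \<Rightarrow> real \<Rightarrow> bool" where
  "decrement_bound b R R' \<longleftrightarrow>
     (\<forall>N A f g \<phi>. 0 < N \<and> mult_closed_ball A \<and> f \<in> unit_fun N \<and> g \<in> uap_unit N A R \<and>
        \<phi> \<in> uap_test N A \<and> b \<le> avg (\<lambda>x. (f x - g x) * \<phi> x) (cyc N) \<longrightarrow>
        (\<exists>g'\<in>uap_unit N A R'. sq_dist N f g' \<le> sq_dist N f g - b\<^sup>2 / 2))"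

lemma decrement_boundD:
  assumes "decrement_bound b R R'" "0 < N" "mult_closed_ball A" "f \<in> unit_fun N" "g \<in> uap_unit N A R"
    "\<phi> \<in> uap_test N A" "b \<le> avg (\<lambda>x. (f x - g x) * \<phi> x) (cyc N)"
  shows "\<exists>g'\<in>uap_unit N A R'. sq_dist N f g' \<le> sq_dist N f g - b\<^sup>2 / 2"
  using assms(1)[unfolded decrement_bound_def, rule_format, of N A f g \<phi>] assms(2-) by simp

text \<open>A step of length \<open>b\<close> along \<open>\<phi>\<close> changes the energy by at
  most \<open>- 2 * b * b + b\<^sup>2\<close>, the truncation does not increase it, and the
  polynomial approximation costs at most \<open>3 * e\<close>.\<close>

lemma energy_decrement:
  assumes b: "0 < b"
  shows "\<exists>R'. decrement_bound b R R'"
proof -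
  \<comment> \<open>With \<open>6 * e \<le> b\<^sup>2\<close> the approximation loses at most half
    of the gain \<open>b\<^sup>2\<close>; \<open>e \<le> 1\<close> absorbs the term
    \<open>e * e\<close>.\<close>
  define e where "e = min 1 (b\<^sup>2 / 6)"
  have e: "0 < e" "e \<le> 1" "6 * e \<le> b\<^sup>2" using b by (auto simp: e_def)
  obtain p where p: "real_polynomial_function p"
    and p01: "\<And>u. u \<in> {-b..1+b} \<Longrightarrow> 0 \<le> p u \<and> p u \<le> 1"
    and pe: "\<And>u. u \<in> {-b..1+b} \<Longrightarrow> \<bar>p u - max 0 (min 1 u)\<bar> \<le> e"
    using polynomial_approximates_truncation[OF e(1), where a = "-b" and b = "1 + b"] by blast
  obtain R' where R': "poly_bound p (R + b * 1) R'" using uap_rep_polynomial[OF p] by blast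
  have "\<exists>g'\<in>uap_unit N A R'. sq_dist N f g' \<le> sq_dist N f g - b\<^sup>2 / 2"
    if N: "0 < N" and A: "mult_closed_ball A" and f: "f \<in> unit_fun N" and g: "g \<in> uap_unit N A R"
      and \<phi>: "\<phi> \<in> uap_test N A" and cor: "b \<le> avg (\<lambda>x. (f x - g x) * \<phi> x) (cyc N)" for N A f g \<phi>
  proof (rule bexI)
    define u where "u = (\<lambda>x. g x + b * \<phi> x)"
    have f01: "0 \<le> f x" "f x \<le> 1" and g01: "0 \<le> g x" "g x \<le> 1" and \<phi>1: "\<bar>\<phi> x\<bar> \<le> 1" for x
      using f g \<phi> by (auto simp: unit_fun_def uap_unit_def uap_test_def)
    have ub: "u x \<in> {-b..1+b}" for x
    proof -
      have "\<bar>b * \<phi> x\<bar> \<le> b" using \<phi>1[of x] b by (simp add: abs_mult)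
      then show ?thesis using g01[of x] unfolding u_def by auto
    qed
    have "uap_rep N A (\<lambda>_. of_real b) b"
      using N A b by (intro uap_rep_const) (auto simp: mult_closed_ball_def)
    from uap_rep_mult[OF N A this, of "\<lambda>x. of_real (\<phi> x)" 1] \<phi>
    have "uap_rep N A (\<lambda>x. of_real b * of_real (\<phi> x)) (b * 1)" by (simp add: uap_test_def)
    with g have u: "uap_rep N A (\<lambda>x. of_real (u x)) (R + b * 1)"
      unfolding u_def of_real_add of_real_mult by (intro uap_rep_add) (auto simp: uap_unit_def)
    then have "(\<lambda>x. complex_of_real (u x)) \<in> cyc_fun N" by (simp add: uap_rep_def)
    then have uc: "u \<in> cyc_fun N" by (simp add: cyc_fun_def)
    show "(\<lambda>x. p (u x)) \<in> uap_unit N A R'"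
      using R' N A u uc p01[OF ub] by (simp add: poly_bound_def uap_unit_def unit_fun_def cyc_fun_def)
    have "(f x - p (u x))\<^sup>2 \<le> ((f x - g x)\<^sup>2 - 2 * b * ((f x - g x) * \<phi> x)) + (b\<^sup>2 + 3 * e)" for x
    proof -
      define c where "c = max 0 (min 1 (u x))"
      \<comment> \<open>Truncation brings \<open>u x\<close> no farther from \<open>f x\<close>,
        which already lies in \<open>[0, 1]\<close>.\<close>
      have fc: "\<bar>f x - c\<bar> \<le> 1" "\<bar>f x - c\<bar> \<le> \<bar>f x - u x\<bar>" using f01[of x] by (auto simp: c_def)
      have "\<bar>f x - p (u x)\<bar> \<le> \<bar>f x - c\<bar> + e" using pe[OF ub, of x] unfolding c_def by linarith
      then have "(f x - p (u x))\<^sup>2 \<le> (\<bar>f x - c\<bar> + e)\<^sup>2" by (intro abs_le_square_iff[THEN iffD1]) auto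
      also have "\<dots> = (f x - c)\<^sup>2 + 2 * (e * \<bar>f x - c\<bar>) + e * e"
        by (simp add: power2_sum) (simp add: power2_eq_square)
      also have "\<dots> \<le> (f x - u x)\<^sup>2 + 2 * (e * 1) + e * 1"
        using fc e by (intro add_mono mult_left_mono) (auto simp: abs_le_square_iff)
      also have "\<dots> = (f x - g x)\<^sup>2 - 2 * b * ((f x - g x) * \<phi> x) + b\<^sup>2 * (\<phi> x)\<^sup>2 + 3 * e"
        by (simp add: u_def power2_eq_square algebra_simps)
      also have "\<dots> \<le> (f x - g x)\<^sup>2 - 2 * b * ((f x - g x) * \<phi> x) + b\<^sup>2 * 1 + 3 * e"
        using mult_left_mono[of "(\<phi> x)\<^sup>2" 1 "b\<^sup>2"] \<phi>1[of x] by (simp add: abs_square_le_1)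
      finally show ?thesis by simp
    qed
    then have "sq_dist N f (\<lambda>x. p (u x)) \<le>
        avg (\<lambda>x. ((f x - g x)\<^sup>2 - 2 * b * ((f x - g x) * \<phi> x)) + (b\<^sup>2 + 3 * e)) (cyc N)"
      unfolding sq_dist_def by (intro avg_mono)
    also have "\<dots> = sq_dist N f g - 2 * b * avg (\<lambda>x. (f x - g x) * \<phi> x) (cyc N) + (b\<^sup>2 + 3 * e)"
      unfolding avg_add avg_diff avg_cmult sq_dist_def avg_const[OF finite_cyc cyc_nonempty[OF N]] ..
    also have "\<dots> \<le> sq_dist N f g - 2 * b * b + (b\<^sup>2 + 3 * e)"
      using cor b by (intro add_mono diff_mono mult_left_mono) auto
    also have "\<dots> \<le> sq_dist N f g - b\<^sup>2 / 2" using e(3) by (simp add: power2_eq_square)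
    finally show "sq_dist N f (\<lambda>x. p (u x)) \<le> sq_dist N f g - b\<^sup>2 / 2" .
  qed
  then show ?thesis unfolding decrement_bound_def by blast
qed

section \<open>Weak regularity by iteration\<close>

lemma uap_unit_mono:
  assumes "0 < N" "mult_closed_ball A" "g \<in> uap_unit N A R" "R \<le> R'"
  shows "g \<in> uap_unit N A R'"
  using assms uap_rep_mono[where M = R and M' = R' and A = A and N = N]
  by (auto simp: uap_unit_def mult_closed_ball_def)

text \<open>The parameter \<open>E\<close> is an energy budget, spent in portions of
  \<open>b\<^sup>2 / 2\<close> by the induction below.\<close>

definition regularity_bound :: "real \<Rightarrow> real \<Rightarrow> real \<Rightarrow> real \<Rightarrow> bool" where
  "regularity_bound b E R R' \<longleftrightarrow>
     (\<forall>N A f g. 0 < N \<and> mult_closed_ball A \<and> f \<in> unit_fun N \<and> g \<in> uap_unit N A R \<and>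
        sq_dist N f g \<le> E \<longrightarrow>
        (\<exists>g'\<in>uap_unit N A R'. sq_dist N f g' \<le> sq_dist N f g \<and>
          (\<forall>\<phi>\<in>uap_test N A. avg (\<lambda>x. (f x - g' x) * \<phi> x) (cyc N) < b)))"

lemma regularity_boundD:
  assumes "regularity_bound b E R R'" "0 < N" "mult_closed_ball A" "f \<in> unit_fun N"
    "g \<in> uap_unit N A R" "sq_dist N f g \<le> E"
  shows "\<exists>g'\<in>uap_unit N A R'. sq_dist N f g' \<le> sq_dist N f g \<and>
    (\<forall>\<phi>\<in>uap_test N A. avg (\<lambda>x. (f x - g' x) * \<phi> x) (cyc N) < b)"
  using assms(1)[unfolded regularity_bound_def, rule_format, of N A f g] assms(2-) by simp

text \<open>Either \<open>g\<close> already passes all tests or one decrement lowers the budget by a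
  portion. At budget 0 a decrement would make the energy negative. The induction is over all
  \<open>R\<close>, since a decrement replaces \<open>R\<close> by \<open>S\<close>.\<close>

lemma energy_decrement_iterate:
  assumes b: "0 < b"
  shows "\<exists>R'. regularity_bound b (real n * (b\<^sup>2 / 2)) R R'"
proof (induction n arbitrary: R)
  case 0
  obtain S where S: "decrement_bound b R S" using energy_decrement[OF b] by blast
  have "avg (\<lambda>x. (f x - g x) * \<phi> x) (cyc N) < b"
    if *: "0 < N" "mult_closed_ball A" "f \<in> unit_fun N" "g \<in> uap_unit N A R"
      "\<phi> \<in> uap_test N A" and "sq_dist N f g \<le> 0" for N A f g \<phi>
  proof (rule ccontr)
    assume "\<not> ?thesis"
    then obtain g' where "sq_dist N f g' \<le> sq_dist N f g - b\<^sup>2 / 2"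
      using decrement_boundD[OF S *] by (auto simp: not_less)
    moreover have "0 < b\<^sup>2" using b by simp
    ultimately show False using \<open>sq_dist N f g \<le> 0\<close> sq_dist_nonneg[of N f g'] by linarith
  qed
  then have "regularity_bound b (real 0 * (b\<^sup>2 / 2)) R R"
    unfolding regularity_bound_def by auto
  then show ?case by blast
next
  case (Suc n)
  obtain S where S: "decrement_bound b R S" using energy_decrement[OF b] by blast
  obtain T where T: "regularity_bound b (real n * (b\<^sup>2 / 2)) S T" using Suc.IH by blast
  \<comment> \<open>The maximum covers both outcomes: stopping at \<open>g\<close> with bound
    \<open>R\<close>, or continuing to a function with bound \<open>T\<close>.\<close>
  have "\<exists>g'\<in>uap_unit N A (max R T). sq_dist N f g' \<le> sq_dist N f g \<and>
      (\<forall>\<phi>\<in>uap_test N A. avg (\<lambda>x. (f x - g' x) * \<phi> x) (cyc N) < b)"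
    if N: "0 < N" and A: "mult_closed_ball A" and f: "f \<in> unit_fun N" and g: "g \<in> uap_unit N A R"
      and en: "sq_dist N f g \<le> real (Suc n) * (b\<^sup>2 / 2)" for N A f g
  proof (cases "\<forall>\<phi>\<in>uap_test N A. avg (\<lambda>x. (f x - g x) * \<phi> x) (cyc N) < b")
    case True
    then show ?thesis using uap_unit_mono[OF N A g, of "max R T"] by (intro bexI[of _ g]) auto
  next
    case False
    then obtain \<phi> where \<phi>: "\<phi> \<in> uap_test N A" "b \<le> avg (\<lambda>x. (f x - g x) * \<phi> x) (cyc N)"
      by (meson not_less)
    obtain g1 where g1: "g1 \<in> uap_unit N A S" "sq_dist N f g1 \<le> sq_dist N f g - b\<^sup>2 / 2"
      using decrement_boundD[OF S N A f g \<phi>] ..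
    have "sq_dist N f g1 \<le> real n * (b\<^sup>2 / 2)" using g1(2) en by (simp add: algebra_simps)
    then obtain g' where g': "g' \<in> uap_unit N A T" "sq_dist N f g' \<le> sq_dist N f g1"
        "\<forall>\<phi>\<in>uap_test N A. avg (\<lambda>x. (f x - g' x) * \<phi> x) (cyc N) < b"
      using regularity_boundD[OF T N A f g1(1)] by blast
    moreover have "sq_dist N f g1 \<le> sq_dist N f g" using g1(2) zero_le_power2[of b] by linarith
    ultimately show ?thesis using uap_unit_mono[OF N A g'(1), of "max R T"] by (intro bexI[of _ g']) auto
  qed
  then have "regularity_bound b (real (Suc n) * (b\<^sup>2 / 2)) R (max R T)"
    unfolding regularity_bound_def by blast
  then show ?case by blast
qed

lemma sq_dist_le_1:
  assumes "0 < N" "f \<in> unit_fun N" "g \<in> unit_fun N"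
  shows "sq_dist N f g \<le> 1"
proof -
  have "\<bar>f x - g x\<bar> \<le> 1" for x
    using assms(2,3) unfolding unit_fun_def mem_Collect_eq abs_le_iff by (smt (verit))
  then have "(f x - g x)\<^sup>2 \<le> 1" for x by (simp add: abs_square_le_1)
  then have "sq_dist N f g \<le> avg (\<lambda>_. 1) (cyc N)" unfolding sq_dist_def by (intro avg_mono)
  then show ?thesis using assms(1) by (simp add: avg_const cyc_nonempty)
qed

lemma weak_regularity:
  assumes b: "0 < b"
  shows "\<exists>R'. regularity_bound b 1 R R'"
proof -
  \<comment> \<open>Energies between functions with values in \<open>[0, 1]\<close> are at most 1,
    so \<open>n\<close> portions cover every possible start.\<close>
  obtain n where "1 / (b\<^sup>2 / 2) < real n" using reals_Archimedean2 by blast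
  then have n: "1 \<le> real n * (b\<^sup>2 / 2)" using b by (simp add: field_simps)
  obtain R' where "regularity_bound b (real n * (b\<^sup>2 / 2)) R R'"
    using energy_decrement_iterate[OF b] by blast
  then have "regularity_bound b 1 R R'"
    unfolding regularity_bound_def using order_trans[OF _ n] by blast
  then show ?thesis by blast
qed

text \<open>If the mean of \<open>g\<close> is too small, \<open>g\<close> is moved towards the
  constant 1 until its mean is \<open>\<delta>\<close>. Since the mean of \<open>g\<close> falls
  short of that of \<open>f\<close> by less than \<open>b\<close>, this adds less than
  \<open>b\<close> on average.\<close>

lemma mean_correction:
  assumes N: "0 < N" and f: "f \<in> unit_fun N" and g: "g \<in> unit_fun N" and \<delta>: "\<delta> \<le> avg f (cyc N)"
    and b: "0 < b" "avg (\<lambda>x. f x - g x) (cyc N) < b"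
  obtains h where "h \<in> cyc_fun N" "\<And>x. 0 \<le> h x" "\<And>x. g x + h x \<le> 1"
    "\<delta> \<le> avg (\<lambda>x. g x + h x) (cyc N)" "avg h (cyc N) \<le> b"
proof (cases "\<delta> \<le> avg g (cyc N)")
  case True
  then show ?thesis
    using g b(1) that[of "\<lambda>_. 0"] by (auto simp: cyc_fun_def unit_fun_def avg_def)
next
  case False
  \<comment> \<open>The proportion for which the mean becomes exactly \<open>\<delta>\<close>. The
    denominator is positive because the mean of \<open>g\<close> is below \<open>\<delta>\<close>,
    which is at most the mean of \<open>f\<close> and hence at most 1.\<close>
  define t where "t = (\<delta> - avg g (cyc N)) / (1 - avg g (cyc N))"
  have "avg f (cyc N) \<le> avg (\<lambda>_. 1) (cyc N)" using f by (intro avg_mono) (auto simp: unit_fun_def)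
  then have 1: "avg f (cyc N) \<le> 1" using N by (simp add: avg_const cyc_nonempty)
  have t: "0 \<le> t" "t \<le> 1" using False \<delta> 1 by (auto simp: t_def divide_le_eq_1)
  have "avg (\<lambda>x. t * (1 - g x)) (cyc N) = t * (1 - avg g (cyc N))"
    unfolding avg_cmult avg_diff avg_const[OF finite_cyc cyc_nonempty[OF N]] ..
  also have "\<dots> = \<delta> - avg g (cyc N)" using False \<delta> 1 by (simp add: t_def)
  finally have avg: "avg (\<lambda>x. t * (1 - g x)) (cyc N) = \<delta> - avg g (cyc N)" .
  have g01: "0 \<le> g x" "g x \<le> 1" for x using g by (auto simp: unit_fun_def)
  show ?thesis
  proof (rule that[of "\<lambda>x. t * (1 - g x)"])
    show "g x + t * (1 - g x) \<le> 1" for x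
      using mult_right_mono[OF t(2), of "1 - g x"] g01[of x] by simp
  qed (use g g01 t avg b \<delta> in \<open>auto simp: cyc_fun_def unit_fun_def avg_add avg_diff\<close>)
qed

subsection \<open>Structure theorem\<close>

text \<open>The mean is corrected first, and \<open>f - g\<close> is then tested against the dual
  function of the corrected difference \<open>f - p\<close>. The test contributes less than
  \<open>b\<close> and the correction at most \<open>b\<close>, so the power of the Gowers norm
  stays below \<open>2 * b\<close>.\<close>

lemma uniform_part_exists:
  assumes N: "0 < N" and f: "f \<in> unit_fun N" "\<delta> \<le> avg f (cyc N)" and g: "g \<in> unit_fun N"
    and b: "0 < b" "2 * b \<le> \<eta> ^ (2 ^ Suc (Suc e))" and \<eta>: "0 \<le> \<eta>"
    and test: "\<And>\<phi>. \<phi> \<in> uap_test N (uap_norm N e) \<Longrightarrow> avg (\<lambda>x. (f x - g x) * \<phi> x) (cyc N) < b"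
  obtains p where "p \<in> unit_fun N" "\<delta> \<le> avg p (cyc N)" "sq_dist N p g \<le> b"
    "gowers_norm N (Suc (Suc e)) (\<lambda>x. of_real (f x - p x)) \<le> \<eta>"
proof -
  have "(\<lambda>_. 1) \<in> uap_test N (uap_norm N e)"
    using uap_rep_const[where A = "uap_norm N e" and a = 1 and M = 1, OF N uap_norm_const_1[OF N]] by (simp add: uap_test_def)
  from test[OF this] have "avg (\<lambda>x. f x - g x) (cyc N) < b" by simp
  from mean_correction[OF N f(1) g f(2) b(1) this] obtain h where h: "h \<in> cyc_fun N"
    "\<And>x. 0 \<le> h x" "\<And>x. g x + h x \<le> 1" "\<delta> \<le> avg (\<lambda>x. g x + h x) (cyc N)" "avg h (cyc N) \<le> b"
    by blast
  define p where "p = (\<lambda>x. g x + h x)"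
  define F where "F = (\<lambda>x. f x - p x)"
  define D where "D = dual_fun N (Suc (Suc e)) F"
  have f01: "0 \<le> f x" "f x \<le> 1" and g01: "0 \<le> g x" "g x \<le> 1" for x
    using f g by (auto simp: unit_fun_def)
  have p01: "0 \<le> p x" "p x \<le> 1" for x using g01(1)[of x] h(2,3)[of x] by (auto simp: p_def)
  have h1: "h x \<le> 1" for x using g01(1)[of x] h(3)[of x] by linarith
  have p: "p \<in> unit_fun N" using p01 h(1) g by (simp add: p_def unit_fun_def cyc_fun_def)
  \<comment> \<open>As \<open>0 \<le> h x \<le> 1\<close>, the square of \<open>h x\<close> is at
    most \<open>h x\<close>.\<close>
  have "sq_dist N p g \<le> avg h (cyc N)"
    unfolding sq_dist_def
    using h(2) h1 by (intro avg_mono) (simp add: p_def power2_eq_square mult_left_le)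
  with h(5) have dist: "sq_dist N p g \<le> b" by linarith
  have F: "F \<in> cyc_fun N" using f(1) p by (simp add: F_def unit_fun_def cyc_fun_def)
  have F1: "\<bar>F x\<bar> \<le> 1" for x
    using f01[of x] p01[of x] unfolding F_def abs_le_iff by linarith
  have D1: "\<bar>D x\<bar> \<le> 1" for x unfolding D_def by (rule abs_dual_fun_le_1[OF F1])
  have "D \<in> uap_test N (uap_norm N e)"
    using uap_rep_dual_fun[OF N F F1, of e] D1 by (simp add: uap_test_def D_def del: dual_fun.simps)
  note test[OF this]
  have "- (h x * D x) \<le> h x" for x
  proof -
    have "h x * - D x \<le> h x * 1" using h(2) D1[of x] by (intro mult_left_mono) auto
    then show ?thesis by simp
  qed
  then have "avg (\<lambda>x. - 1 * (h x * D x)) (cyc N) \<le> avg h (cyc N)" by (intro avg_mono) simp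
  then have hD: "- avg (\<lambda>x. h x * D x) (cyc N) \<le> b" using h(5) unfolding avg_cmult by simp
  let ?r = "gowers_norm N (Suc (Suc e)) (\<lambda>x. of_real (F x))"
  have "?r ^ (2 ^ Suc (Suc e)) = avg (\<lambda>x. F x * D x) (cyc N)"
    unfolding D_def by (rule gowers_norm_dual_fun(2)[OF N F])
  also have "\<dots> = avg (\<lambda>x. (f x - g x) * D x - h x * D x) (cyc N)"
    by (simp add: F_def p_def algebra_simps)
  also have "\<dots> < 2 * b" using test[OF \<open>D \<in> _\<close>] hD unfolding avg_diff by linarith
  finally have "?r ^ (2 ^ Suc (Suc e)) \<le> \<eta> ^ (2 ^ Suc (Suc e))" using b(2) by linarith
  then have "?r \<le> \<eta>" using power_mono_iff[OF gowers_norm_dual_fun(1)[OF N F] \<eta>] by simp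
  then show ?thesis using that[OF p] h(4) dist by (simp add: p_def F_def)
qed

text \<open>The parallelogram law for \<open>f - g\<close> and \<open>f - g'\<close>.\<close>

lemma sq_dist_midpoint:
  "sq_dist N f (\<lambda>x. 1 / 2 * (g x + g' x)) =
     1 / 2 * sq_dist N f g + 1 / 2 * sq_dist N f g' - 1 / 4 * sq_dist N g' g"
  unfolding sq_dist_def avg_cmult[symmetric] avg_add[symmetric] avg_diff[symmetric]
  by (rule arg_cong2[where f = avg]) (auto simp: power2_eq_square field_simps)

lemma sq_dist_triangle: "sq_dist N p g \<le> 2 * sq_dist N p g' + 2 * sq_dist N g' g"
  unfolding sq_dist_def avg_cmult[symmetric] avg_add[symmetric]
proof (rule avg_mono)
  fix x
  show "(p x - g x)\<^sup>2 \<le> 2 * (p x - g' x)\<^sup>2 + 2 * (g' x - g x)\<^sup>2"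
    using zero_le_power2[of "p x - 2 * g' x + g x"] by (simp add: power2_eq_square algebra_simps)
qed

text \<open>The decomposition sought, with the uniform part written as \<open>f - p\<close>. The
  threshold \<open>\<epsilon>\<close> is kept apart from \<open>M\<close>; the iteration links the
  two.\<close>

definition structured :: "nat \<Rightarrow> nat \<Rightarrow> real \<Rightarrow> real \<Rightarrow> real \<Rightarrow> real \<Rightarrow> (int \<Rightarrow> real) \<Rightarrow> bool" where
  "structured N e \<sigma> \<delta> \<epsilon> M f \<longleftrightarrow>
     (\<exists>p q. p \<in> unit_fun N \<and> q \<in> unit_fun N \<and>
        L2_norm_cyc N (\<lambda>x. p x - q x) \<le> \<sigma> \<and> \<delta> \<le> avg p (cyc N) \<and>
        uap_norm N (Suc e) (\<lambda>x. of_real (q x)) < ennreal M \<and>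
        gowers_norm N (Suc (Suc e)) (\<lambda>x. of_real (f x - p x)) \<le> \<epsilon>)"

text \<open>
  If the regularised \<open>g'\<close> is far from \<open>g\<close> although \<open>g'\<close> has no larger energy, then by the
  parallelogram law the midpoint of \<open>g\<close> and \<open>g'\<close> has much less.
\<close>

lemma structured_or_energy_decrement:
  assumes \<sigma>: "0 < \<sigma>" and \<epsilon>: "0 < \<epsilon>" and M: "0 < M" "R < M"
  shows "\<exists>R'. \<forall>N f g. 0 < N \<and> f \<in> unit_fun N \<and> \<delta> \<le> avg f (cyc N) \<and> g \<in> uap_unit N (uap_norm N e) R \<longrightarrow>
    structured N e \<sigma> \<delta> \<epsilon> M f \<or>
    (\<exists>g'\<in>uap_unit N (uap_norm N e) R'. sq_dist N f g' \<le> sq_dist N f g - \<sigma>\<^sup>2 / 16)"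
proof -
  \<comment> \<open>The first bound limits the mean correction to half of
    \<open>\<sigma>\<^sup>2\<close> in the squared triangle inequality, leaving
    \<open>\<sigma>\<^sup>2 / 4\<close> for the distance from \<open>g'\<close> to \<open>g\<close>.
    The second yields the Gowers norm threshold.\<close>
  define b where "b = min (\<sigma>\<^sup>2 / 4) (\<epsilon> ^ (2 ^ Suc (Suc e)) / 2)"
  have b: "0 < b" "b \<le> \<sigma>\<^sup>2 / 4" "2 * b \<le> \<epsilon> ^ (2 ^ Suc (Suc e))"
    using \<sigma> \<epsilon> by (auto simp: b_def)
  obtain S where S: "regularity_bound b 1 R S" using weak_regularity[OF b(1)] by blast
  have "structured N e \<sigma> \<delta> \<epsilon> M f \<or>
    (\<exists>g'\<in>uap_unit N (uap_norm N e) (R + S). sq_dist N f g' \<le> sq_dist N f g - \<sigma>\<^sup>2 / 16)"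
    if N: "0 < N" and f: "f \<in> unit_fun N" "\<delta> \<le> avg f (cyc N)"
      and g: "g \<in> uap_unit N (uap_norm N e) R" for N f g
  proof -
    let ?A = "uap_norm N e"
    have "sq_dist N f g \<le> 1" using N f(1) g by (intro sq_dist_le_1) (auto simp: uap_unit_def)
    from regularity_boundD[OF S N mult_closed_ball_uap_norm[OF N] f(1) g this]
    obtain g' where g': "g' \<in> uap_unit N ?A S" "sq_dist N f g' \<le> sq_dist N f g"
      "\<And>\<phi>. \<phi> \<in> uap_test N ?A \<Longrightarrow> avg (\<lambda>x. (f x - g' x) * \<phi> x) (cyc N) < b"
      by blast
    have gu: "g \<in> unit_fun N" "g' \<in> unit_fun N" using g g' by (auto simp: uap_unit_def)
    obtain p where p: "p \<in> unit_fun N" "\<delta> \<le> avg p (cyc N)" "sq_dist N p g' \<le> b"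
      "gowers_norm N (Suc (Suc e)) (\<lambda>x. of_real (f x - p x)) \<le> \<epsilon>"
      using uniform_part_exists[OF N f gu(2) b(1,3) less_imp_le[OF \<epsilon>] g'(3)] by blast
    show ?thesis
    proof (cases "L2_norm_cyc N (\<lambda>x. p x - g x) \<le> \<sigma>")
      case True
      have rep: "uap_rep N ?A (\<lambda>x. of_real (g x)) R" using g by (simp add: uap_unit_def)
      have "uap_norm N (Suc e) (\<lambda>x. of_real (g x)) \<le> ennreal R"
        using uap_rep_imp_uap_of_le[OF rep] by simp
      also have "\<dots> < ennreal M" using M by (simp add: ennreal_less_iff uap_rep_nonneg[OF rep])
      finally show ?thesis using True p gu unfolding structured_def by blast
    next
      case False
      have "L2_norm_cyc N (\<lambda>x. p x - g x) = sqrt (sq_dist N p g)"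
        by (simp add: L2_norm_cyc_def sq_dist_def)
      with False have "\<sigma>\<^sup>2 \<le> sq_dist N p g" using \<sigma> by (metis not_le real_le_lsqrt less_imp_le sq_dist_nonneg)
      then have "\<sigma>\<^sup>2 / 4 \<le> sq_dist N g' g"
        using sq_dist_triangle[of N p g g'] p(3) b(2) by linarith
      \<comment> \<open>A quarter of \<open>\<sigma>\<^sup>2 / 4\<close> is gained. Only
        \<open>R'\<close> depends on \<open>\<epsilon>\<close>; this gain does not.\<close>
      with g'(2) have "sq_dist N f (\<lambda>x. 1 / 2 * (g x + g' x)) \<le> sq_dist N f g - \<sigma>\<^sup>2 / 16"
        unfolding sq_dist_midpoint by linarith
      moreover have "(\<lambda>x. 1 / 2 * (g x + g' x)) \<in> uap_unit N ?A (R + S)"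
      proof -
        have "uap_rep N ?A (\<lambda>_. of_real (1 / 2)) 1"
          using N uap_norm_const_1 by (intro uap_rep_const) auto
        moreover have "uap_rep N ?A (\<lambda>x. of_real (g x) + of_real (g' x)) (R + S)"
          using g g' by (intro uap_rep_add) (auto simp: uap_unit_def)
        ultimately have "uap_rep N ?A (\<lambda>x. of_real (1 / 2) * (of_real (g x) + of_real (g' x))) (1 * (R + S))"
          by (intro uap_rep_mult N mult_closed_ball_uap_norm)
        moreover have "(\<lambda>x. 1 / 2 * (g x + g' x)) \<in> unit_fun N"
          using gu by (auto simp: unit_fun_def cyc_fun_def intro: order_trans[OF add_mono])
        ultimately show ?thesis by (simp add: uap_unit_def)
      qed
      ultimately show ?thesis by blast
    qed
  qed
  then show ?thesis by blast
qed

text \<open>Each restart worsens the bound \<open>R\<close>, so \<open>M\<close> and the threshold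
  \<open>\<eta> M\<close> are chosen afresh. The gain per restart is independent of the threshold,
  so the energy budget limits the restarts to \<open>n\<close>, however fast \<open>\<eta>\<close>
  decays.\<close>

lemma structure_iteration:
  fixes \<eta> :: "real \<Rightarrow> real"
  assumes \<sigma>: "0 < \<sigma>" and \<eta>: "\<And>M. 0 < M \<Longrightarrow> 0 < \<eta> M"
  shows "\<exists>M0. \<forall>N f g. 0 < N \<and> f \<in> unit_fun N \<and> \<delta> \<le> avg f (cyc N) \<and>
    g \<in> uap_unit N (uap_norm N e) R \<and> sq_dist N f g \<le> real n * (\<sigma>\<^sup>2 / 16) \<longrightarrow>
    (\<exists>M. 0 < M \<and> M \<le> M0 \<and> structured N e \<sigma> \<delta> (\<eta> M) M f)"
proof (induction n arbitrary: R)
  case 0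
  \<comment> \<open>Any positive \<open>M\<close> above \<open>R\<close> would do, strictly because
    the norm has to be less than \<open>M\<close>. It is fixed before the threshold
    \<open>\<eta> M\<close>, on which \<open>R'\<close> then depends.\<close>
  define M where "M = max 0 R + 1"
  have M: "0 < M" "R < M" by (auto simp: M_def)
  obtain R' where R': "\<And>N f g. 0 < N \<and> f \<in> unit_fun N \<and> \<delta> \<le> avg f (cyc N) \<and>
      g \<in> uap_unit N (uap_norm N e) R \<Longrightarrow> structured N e \<sigma> \<delta> (\<eta> M) M f \<or>
      (\<exists>g'\<in>uap_unit N (uap_norm N e) R'. sq_dist N f g' \<le> sq_dist N f g - \<sigma>\<^sup>2 / 16)"
    using structured_or_energy_decrement[OF \<sigma> \<eta>[OF M(1)] M] by blast
  have "\<not> sq_dist N f g' \<le> sq_dist N f g - \<sigma>\<^sup>2 / 16" if "sq_dist N f g \<le> 0" for N f g g'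
  proof -
    have "0 < \<sigma>\<^sup>2 / 16" using \<sigma> by simp
    then show ?thesis using that sq_dist_nonneg[of N f g'] by linarith
  qed
  then have "structured N e \<sigma> \<delta> (\<eta> M) M f"
    if "0 < N \<and> f \<in> unit_fun N \<and> \<delta> \<le> avg f (cyc N) \<and> g \<in> uap_unit N (uap_norm N e) R"
      "sq_dist N f g \<le> 0" for N f g
    using R'[OF that(1)] that(2) by blast
  then show ?case using M(1) by (intro exI[of _ M]) auto
next
  case (Suc n)
  define M where "M = max 0 R + 1"
  have M: "0 < M" "R < M" by (auto simp: M_def)
  obtain R' where R': "\<And>N f g. 0 < N \<and> f \<in> unit_fun N \<and> \<delta> \<le> avg f (cyc N) \<and>
      g \<in> uap_unit N (uap_norm N e) R \<Longrightarrow> structured N e \<sigma> \<delta> (\<eta> M) M f \<or>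
      (\<exists>g'\<in>uap_unit N (uap_norm N e) R'. sq_dist N f g' \<le> sq_dist N f g - \<sigma>\<^sup>2 / 16)"
    using structured_or_energy_decrement[OF \<sigma> \<eta>[OF M(1)] M] by blast
  obtain M1 where M1: "\<And>N f g. 0 < N \<and> f \<in> unit_fun N \<and> \<delta> \<le> avg f (cyc N) \<and>
      g \<in> uap_unit N (uap_norm N e) R' \<and> sq_dist N f g \<le> real n * (\<sigma>\<^sup>2 / 16) \<Longrightarrow>
      (\<exists>M. 0 < M \<and> M \<le> M1 \<and> structured N e \<sigma> \<delta> (\<eta> M) M f)"
    using Suc.IH by blast
  \<comment> \<open>Stopping now uses \<open>M\<close>; a restart from \<open>g'\<close> ends with a
    value of at most \<open>M1\<close>.\<close>
  have "\<exists>M'. 0 < M' \<and> M' \<le> max M M1 \<and> structured N e \<sigma> \<delta> (\<eta> M') M' f"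
    if f: "0 < N \<and> f \<in> unit_fun N \<and> \<delta> \<le> avg f (cyc N)" and g: "g \<in> uap_unit N (uap_norm N e) R"
      "sq_dist N f g \<le> real (Suc n) * (\<sigma>\<^sup>2 / 16)" for N f g
  proof (cases "structured N e \<sigma> \<delta> (\<eta> M) M f")
    case True
    then show ?thesis using M(1) by (intro exI[of _ M]) auto
  next
    case False
    then obtain g' where g': "g' \<in> uap_unit N (uap_norm N e) R'"
        "sq_dist N f g' \<le> sq_dist N f g - \<sigma>\<^sup>2 / 16"
      using R' f g(1) by blast
    have "sq_dist N f g' \<le> real n * (\<sigma>\<^sup>2 / 16)" using g(2) g'(2) by (simp add: algebra_simps)
    with M1 f g'(1) obtain M' where "0 < M'" "M' \<le> M1" "structured N e \<sigma> \<delta> (\<eta> M') M' f" by blast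
    then show ?thesis by (intro exI[of _ M']) auto
  qed
  then show ?case by blast
qed

theorem theorem3p5:
  fixes c0 :: "nat \<Rightarrow> nat \<Rightarrow> real \<Rightarrow> real \<Rightarrow> real"
    and k :: nat and \<delta> :: real
  assumes "recurrence_bound c0"
    and "k \<ge> 3" and "\<delta> > 0"
  shows "\<exists>M0 :: real. \<forall>(N :: nat) (f :: int \<Rightarrow> real).
           prime N \<and> f \<in> unit_fun N \<and> avg f (cyc N) \<ge> \<delta> \<longrightarrow>
           (\<exists>(M :: real) (fU :: int \<Rightarrow> complex) (fUperp :: int \<Rightarrow> real) (fUAP :: int \<Rightarrow> real).
              0 < M \<and> M \<le> M0 \<and>
              fU \<in> bounded_fun N \<and> fUperp \<in> unit_fun N \<and> fUAP \<in> unit_fun N \<and>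
              (\<forall>x. complex_of_real (f x) = fU x + complex_of_real (fUperp x)) \<and>
              L2_norm_cyc N (\<lambda>x. fUperp x - fUAP x) \<le> \<delta>\<^sup>2 / (1024 * real k) \<and>
              avg fUperp (cyc N) \<ge> \<delta> \<and>
              uap_norm N (k - 2) (\<lambda>x. complex_of_real (fUAP x)) < ennreal M \<and>
              gowers_norm N (k - 1) fU \<le> (1 / 2) ^ k * c0 (k - 2) k \<delta> M)"
proof -
  \<comment> \<open>As \<open>k \<ge> 3\<close>, no truncated subtraction occurs: the almost
    periodicity order is \<open>Suc e\<close> and the Gowers order is
    \<open>Suc (Suc e)\<close>.\<close>
  define e where "e = k - 3"
  have e: "k - 2 = Suc e" "k - 1 = Suc (Suc e)" using assms(2) by (auto simp: e_def)
  define \<sigma> where "\<sigma> = \<delta>\<^sup>2 / (1024 * real k)"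
  define \<eta> where "\<eta> = (\<lambda>M. (1 / 2) ^ k * c0 (k - 2) k \<delta> M)"
  have \<sigma>: "0 < \<sigma>" using assms by (simp add: \<sigma>_def)
  have \<eta>: "0 < \<eta> M" if "0 < M" for M
    using assms that unfolding recurrence_bound_def \<eta>_def by simp
  \<comment> \<open>The budget must cover the initial energy, which is at most 1, in portions of
    \<open>\<sigma>\<^sup>2 / 16\<close>.\<close>
  obtain n where "1 / (\<sigma>\<^sup>2 / 16) < real n" using reals_Archimedean2 by blast
  then have n: "1 \<le> real n * (\<sigma>\<^sup>2 / 16)" using \<sigma> by (simp add: field_simps)
  obtain M0 where M0: "\<And>N f g. 0 < N \<and> f \<in> unit_fun N \<and> \<delta> \<le> avg f (cyc N) \<and>
    g \<in> uap_unit N (uap_norm N e) 0 \<and> sq_dist N f g \<le> real n * (\<sigma>\<^sup>2 / 16) \<Longrightarrow>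
    (\<exists>M. 0 < M \<and> M \<le> M0 \<and> structured N e \<sigma> \<delta> (\<eta> M) M f)"
    using structure_iteration[where \<eta> = \<eta>, OF \<sigma> \<eta>] by blast
  show ?thesis
  proof (rule exI[of _ M0], intro allI impI, elim conjE)
    fix N f assume "prime N" and f: "f \<in> unit_fun N" "\<delta> \<le> avg f (cyc N)"
    then have N: "0 < N" by (simp add: prime_gt_0_nat)
    \<comment> \<open>The iteration starts from the zero function, whose bound 0 depends on neither
      \<open>N\<close> nor \<open>f\<close>.\<close>
    have g: "(\<lambda>_. 0) \<in> uap_unit N (uap_norm N e) 0"
      using uap_rep_const[where A = "uap_norm N e" and a = 0 and M = 0, OF N uap_norm_const_1[OF N]]
      by (simp add: uap_unit_def unit_fun_def cyc_fun_def)
    have "sq_dist N f (\<lambda>_. 0) \<le> 1" using N f(1) g by (intro sq_dist_le_1) (auto simp: uap_unit_def)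
    with n have "sq_dist N f (\<lambda>_. 0) \<le> real n * (\<sigma>\<^sup>2 / 16)" by linarith
    with M0 N f g obtain M where "0 < M" "M \<le> M0" "structured N e \<sigma> \<delta> (\<eta> M) M f" by blast
    then obtain p q where *: "0 < M" "M \<le> M0" "p \<in> unit_fun N" "q \<in> unit_fun N"
      "L2_norm_cyc N (\<lambda>x. p x - q x) \<le> \<sigma>" "\<delta> \<le> avg p (cyc N)"
      "uap_norm N (Suc e) (\<lambda>x. of_real (q x)) < ennreal M"
      "gowers_norm N (Suc (Suc e)) (\<lambda>x. of_real (f x - p x)) \<le> \<eta> M" unfolding structured_def by blast
    have "\<bar>f x - p x\<bar> \<le> 1" for x
      using f(1) *(3) unfolding unit_fun_def mem_Collect_eq abs_le_iff by (smt (verit))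
    then have "(\<lambda>x. complex_of_real (f x - p x)) \<in> bounded_fun N"
      using f(1) *(3) unfolding bounded_fun_iff[OF N] norm_of_real by (simp add: unit_fun_def cyc_fun_def)
    then show "\<exists>M fU fUperp fUAP. 0 < M \<and> M \<le> M0 \<and>
              fU \<in> bounded_fun N \<and> fUperp \<in> unit_fun N \<and> fUAP \<in> unit_fun N \<and>
              (\<forall>x. complex_of_real (f x) = fU x + complex_of_real (fUperp x)) \<and>
              L2_norm_cyc N (\<lambda>x. fUperp x - fUAP x) \<le> \<delta>\<^sup>2 / (1024 * real k) \<and>
              avg fUperp (cyc N) \<ge> \<delta> \<and>
              uap_norm N (k - 2) (\<lambda>x. complex_of_real (fUAP x)) < ennreal M \<and>
              gowers_norm N (k - 1) fU \<le> (1 / 2) ^ k * c0 (k - 2) k \<delta> M"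
      using * unfolding e \<sigma>_def \<eta>_def
      by (intro exI[of _ M] exI[of _ "\<lambda>x. of_real (f x - p x)"] exI[of _ p] exI[of _ q] conjI) auto
  qed
qed

end
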